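(* Let $u=(u_k)_{k\in\mathbb N}\in c_0(\mathbb R)$. The following assertions hold: 1. For all $k\in\mathbb N$, $S_u^{k,\infty}=\sup_{l\ge k}u_l\ge 0$; 2. $\mathrm{Pos}^{\geqslant}_u\neq\emptyset \iff \Delta^{\geqslant}_u\neq\emptyset$; 3. $\mathrm{Pos}^{>}_u\neq\emptyset \iff \Delta^{>}_u\neq\emptyset$; 4. $\Delta^{>}_u=\emptyset \iff S_u^{0,\infty}=0$.
   Context: $\mathbb N=\{0,1,2,\dots\}$. $c_0(\mathbb R)$ is the set of real sequences $u=(u_0,u_1,\dots)$ with $\lim_{n\to+\infty}u_n=0$. For $u\in c_0(\mathbb R)$ and $n\in\mathbb N$, $m\in\mathbb N\cup\{\infty\}$ with $n\le m$, $S_u^{n,m}$ denotes $\sup_{n\le k\le m}u_k$ if $m<\infty$ and $\sup_{k\ge n}u_k$ if $m=\infty$. Define $\Delta^{\geqslant}_u=\{k\in\mathbb N\mid S_u^{0,k}\ge S_u^{k+1,\infty}\}$, $\Delta^{>}_u=\{k\in\mathbb N\mid S_u^{0,k}> S_u^{k+1,\infty}\}$, $\mathrm{Pos}^{\geqslant}_u=\{k\in\mathbb N\mid u_k\ge 0\}$, $\mathrm{Pos}^{>}_u=\{k\in\mathbb N\mid u_k>0\}$. *)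

theory Defs
  imports Complex_Main "HOL-Library.Extended_Nat"
begin

definition c0 :: "(nat \<Rightarrow> real) set" where
  "c0 = {u. u \<longlonglongrightarrow> 0}"

(* The suprema are taken in the type real, whose Sup is only meaningful for nonempty sets that
   are bounded above.  Sequences in c0 are bounded, so this is the actual supremum whenever
   u is in c0 and enat n \<le> m; for m < n the index set is empty and the value is junk. *)
definition sup_range :: "(nat \<Rightarrow> real) \<Rightarrow> nat \<Rightarrow> enat \<Rightarrow> real" where
  "sup_range u n m = (case m of enat j \<Rightarrow> (SUP k\<in>{n..j}. u k) | \<infinity> \<Rightarrow> (SUP k\<in>{n..}. u k))"

definition Delta_ge :: "(nat \<Rightarrow> real) \<Rightarrow> nat set" where
  "Delta_ge u = {k. sup_range u 0 (enat k) \<ge> sup_range u (k + 1) \<infinity>}"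

definition Delta_gt :: "(nat \<Rightarrow> real) \<Rightarrow> nat set" where
  "Delta_gt u = {k. sup_range u 0 (enat k) > sup_range u (k + 1) \<infinity>}"

definition Pos_ge :: "(nat \<Rightarrow> real) \<Rightarrow> nat set" where
  "Pos_ge u = {k. u k \<ge> 0}"

definition Pos_gt :: "(nat \<Rightarrow> real) \<Rightarrow> nat set" where
  "Pos_gt u = {k. u k > 0}"

end

theory Submission
  imports Defs
begin

text \<open>
  A null sequence is bounded, so its tail suprema are genuine suprema; they are nonnegative and
  eventually drop below any given positive number (\<open>tail_Sup_nonneg\<close>,
  \<open>tail_Sup_eventually_less\<close>). An initial supremum, by contrast, is a maximum over a finite
  set: it is attained by one of the terms (\<open>initial_Sup_attained\<close>).

  Hence if an initial maximum dominates (strictly) the following tail supremum, which is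
  nonnegative, the term attaining that maximum is nonnegative (positive). Conversely, a positive
  term dominates strictly all sufficiently late tail suprema, so it places a late index in
  \<open>Delta_gt\<close>. If only a zero term exists, the sequence is nonpositive and all its tail suprema
  vanish, so the index of that term lies in \<open>Delta_ge\<close>. The last equivalence follows from the
  third: there is no positive term exactly when the total supremum, which is nonnegative, is 0.
\<close>

lemma c0_bdd_above:
  assumes "u \<in> c0"
  shows "bdd_above (u ` A)"
proof -
  have "convergent u"
    using assms by (auto simp: c0_def convergent_def)
  then have "bdd_above (range u)"
    by (intro Bseq_bdd_above convergent_imp_Bseq)
  then show ?thesis
    by (rule bdd_above_mono) auto
qed

text \<open>The tail supremum bounds every term of the tail, and therefore their limit 0.\<close>

lemma tail_Sup_nonneg:
  assumes "u \<in> c0"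
  shows "0 \<le> (SUP l\<in>{k..}. u l)"
proof (rule LIMSEQ_le_const2)
  show "u \<longlonglongrightarrow> 0"
    using assms by (simp add: c0_def)
  show "\<exists>N. \<forall>n\<ge>N. u n \<le> (SUP l\<in>{k..}. u l)"
    using c0_bdd_above[OF assms] by (auto intro!: exI[of _ k] cSUP_upper)
qed

lemma tail_Sup_eventually_less:
  assumes "u \<in> c0" and "0 < a"
  shows "\<forall>\<^sub>F k in sequentially. (SUP l\<in>{k..}. u l) < a"
proof -
  \<comment> \<open>Halving leaves room for the inequality to become weak on passing to the supremum.\<close>
  have "\<forall>\<^sub>F n in sequentially. u n < a / 2"
    using assms by (intro order_tendstoD(2)[of u 0]) (auto simp: c0_def)
  then obtain N where N: "\<And>n. n \<ge> N \<Longrightarrow> u n < a / 2"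
    by (auto simp: eventually_sequentially)
  have "(SUP l\<in>{k..}. u l) < a" if "k \<ge> N" for k
  proof -
    have "(SUP l\<in>{k..}. u l) \<le> a / 2"
      using N that by (intro cSUP_least) (auto intro: less_imp_le)
    then show ?thesis
      using \<open>0 < a\<close> by linarith
  qed
  then show ?thesis
    by (auto simp: eventually_sequentially)
qed

lemma initial_Sup_attained: "\<exists>j\<le>k. sup_range u 0 (enat k) = u j"
proof -
  have "sup_range u 0 (enat k) = Max (u ` {0..k})"
    by (simp add: sup_range_def cSup_eq_Max)
  also have "\<dots> \<in> u ` {0..k}"
    by (intro Max_in) auto
  finally show ?thesis
    by auto
qed

lemma initial_Sup_upper: "j \<le> k \<Longrightarrow> u j \<le> sup_range u 0 (enat k)"
  by (auto simp: sup_range_def intro!: cSUP_upper)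

lemma positive_term_imp_Delta_gt:
  assumes "u \<in> c0" and "0 < u j"
  shows "Delta_gt u \<noteq> {}"
proof -
  obtain N where N: "\<And>k. k \<ge> N \<Longrightarrow> (SUP l\<in>{k..}. u l) < u j"
    using tail_Sup_eventually_less[OF assms] by (auto simp: eventually_sequentially)
  \<comment> \<open>The initial segment must contain \<open>j\<close> and the tail must start beyond \<open>N\<close>.\<close>
  define k where "k = max j N"
  have "sup_range u (k + 1) \<infinity> < u j"
    using N[of "k + 1"] by (simp add: k_def sup_range_def)
  also have "u j \<le> sup_range u 0 (enat k)"
    by (rule initial_Sup_upper) (simp add: k_def)
  finally show ?thesis
    by (auto simp: Delta_gt_def)
qed

lemma Delta_gt_subset_Delta_ge: "Delta_gt u \<subseteq> Delta_ge u"
  by (auto simp: Delta_gt_def Delta_ge_def)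

lemma tail_Sup_nonpos:
  assumes "Pos_gt u = {}"
  shows "(SUP l\<in>{k..}. u l) \<le> 0"
  using assms by (intro cSUP_least) (auto simp: Pos_gt_def not_less)

lemma Pos_gt_iff_Delta_gt:
  assumes "u \<in> c0"
  shows "Pos_gt u \<noteq> {} \<longleftrightarrow> Delta_gt u \<noteq> {}"
proof
  assume "Pos_gt u \<noteq> {}"
  then show "Delta_gt u \<noteq> {}"
    using positive_term_imp_Delta_gt[OF assms] by (auto simp: Pos_gt_def)
next
  assume "Delta_gt u \<noteq> {}"
  then obtain k where k: "sup_range u (k + 1) \<infinity> < sup_range u 0 (enat k)"
    by (auto simp: Delta_gt_def)
  obtain j where "sup_range u 0 (enat k) = u j"
    using initial_Sup_attained by blast
  with k have "0 < u j"
    using tail_Sup_nonneg[OF assms, of "k + 1"] by (simp add: sup_range_def)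
  then show "Pos_gt u \<noteq> {}"
    by (auto simp: Pos_gt_def)
qed

lemma Pos_ge_iff_Delta_ge:
  assumes "u \<in> c0"
  shows "Pos_ge u \<noteq> {} \<longleftrightarrow> Delta_ge u \<noteq> {}"
proof
  assume "Pos_ge u \<noteq> {}"
  then obtain j where j: "0 \<le> u j"
    by (auto simp: Pos_ge_def)
  show "Delta_ge u \<noteq> {}"
  proof (cases "Pos_gt u = {}")
    case True
    have "sup_range u (j + 1) \<infinity> \<le> 0"
      using tail_Sup_nonpos[OF True] by (simp add: sup_range_def)
    also have "0 \<le> sup_range u 0 (enat j)"
      using j initial_Sup_upper[of j j u] by simp
    finally show ?thesis
      by (auto simp: Delta_ge_def)
  next
    case False
    then show ?thesis
      using Pos_gt_iff_Delta_gt[OF assms] Delta_gt_subset_Delta_ge[of u] by auto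
  qed
next
  assume "Delta_ge u \<noteq> {}"
  then obtain k where k: "sup_range u (k + 1) \<infinity> \<le> sup_range u 0 (enat k)"
    by (auto simp: Delta_ge_def)
  obtain j where "sup_range u 0 (enat k) = u j"
    using initial_Sup_attained by blast
  with k have "0 \<le> u j"
    using tail_Sup_nonneg[OF assms, of "k + 1"] by (simp add: sup_range_def)
  then show "Pos_ge u \<noteq> {}"
    by (auto simp: Pos_ge_def)
qed

lemma Pos_gt_empty_iff_Sup_zero:
  assumes "u \<in> c0"
  shows "Pos_gt u = {} \<longleftrightarrow> sup_range u 0 \<infinity> = 0"
proof
  assume "Pos_gt u = {}"
  then show "sup_range u 0 \<infinity> = 0"
    using tail_Sup_nonpos[of u 0] tail_Sup_nonneg[OF assms, of 0] by (simp add: sup_range_def)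
next
  assume zero: "sup_range u 0 \<infinity> = 0"
  have "u j \<le> sup_range u 0 \<infinity>" for j
    using c0_bdd_above[OF assms] by (auto simp: sup_range_def intro!: cSUP_upper)
  with zero show "Pos_gt u = {}"
    by (auto simp: Pos_gt_def not_less)
qed

theorem proposition1:
  fixes u :: "nat \<Rightarrow> real"
  assumes "u \<in> c0"
  shows "(\<forall>k. sup_range u k \<infinity> = (SUP l\<in>{k..}. u l) \<and> (SUP l\<in>{k..}. u l) \<ge> 0)
    \<and> (Pos_ge u \<noteq> {} \<longleftrightarrow> Delta_ge u \<noteq> {})
    \<and> (Pos_gt u \<noteq> {} \<longleftrightarrow> Delta_gt u \<noteq> {})
    \<and> (Delta_gt u = {} \<longleftrightarrow> sup_range u 0 \<infinity> = 0)"
proof (intro conjI allI)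
  show "sup_range u k \<infinity> = (SUP l\<in>{k..}. u l)" for k
    by (simp add: sup_range_def)
  show "(SUP l\<in>{k..}. u l) \<ge> 0" for k
    using assms by (rule tail_Sup_nonneg)
  show "Pos_ge u \<noteq> {} \<longleftrightarrow> Delta_ge u \<noteq> {}"
    using assms by (rule Pos_ge_iff_Delta_ge)
  show "Pos_gt u \<noteq> {} \<longleftrightarrow> Delta_gt u \<noteq> {}"
    using assms by (rule Pos_gt_iff_Delta_gt)
  show "Delta_gt u = {} \<longleftrightarrow> sup_range u 0 \<infinity> = 0"
    using Pos_gt_iff_Delta_gt[OF assms] Pos_gt_empty_iff_Sup_zero[OF assms] by blast
qed

end
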